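(* Let $H$ be a directed $m$-uniform hypergraph on $n$ vertices with $m$ even, let $A_H^+$ be its out-adjacency hypermatrix, and let $\overline{A_H^+}$ be the supersymmetric hypermatrix in $M_{m,n}$ with $\overline{A_H^+}x^m=A_H^+x^m$ for all $x$. Then the maximum $Z$-eigenvalue of $A_H^+$ is less than or equal to the maximum $Z$-eigenvalue of $\overline{A_H^+}$.
   Context: $M_{m,n}$ is the set of real hypermatrices (tensors) $A=(a_{i_1i_2\dots i_m})$, $1\le i_1,\dots,i_m\le n$; $A$ is supersymmetric if its entries are invariant under all permutations of the indices. For a vector $x$, $Ax^{m-1}$ is the vector with $i$-th entry $\sum_{i_2,\dots,i_m=1}^n a_{ii_2\dots i_m}x_{i_2}\cdots x_{i_m}$, and $Ax^m=\sum_{i_1,\dots,i_m=1}^n a_{i_1\dots i_m}x_{i_1}\cdots x_{i_m}$. For nonzero $A$, a pair $(\lambda,x)\in\mathbb R\times(\mathbb R^n\setminus\{0\})$ is a $Z$-eigenpair ($\lambda$ a $Z$-eigenvalue) if $Ax^{m-1}=\lambda x$ and $\sum_i x_i^2=1$. A directed hypergraph $H=(V,E)$ has a finite vertex set $V=\{v_1,\dots,v_n\}$ and a set $E$ of edges; each edge $e$ is a subset of $V$ with a partition $e=T_e\sqcup H_e$ into a nonempty tail $T_e$ and a nonempty head $H_e$, and distinct edges $e_1\ne e_2$ satisfy $T_{e_1}\cup H_{e_1}\neq T_{e_2}\cup H_{e_2}$. It is $m$-uniform if $|e|=m$ for all $e\in E$. Out-adjacency hypermatrix $A_H^+=(a^+_{i_1\dots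 i_m})\in M_{m,n}$ of a directed $m$-uniform hypergraph: for each edge $e$ with $|T_e|=k$, $a^+_{i_1\dots i_m}=\frac{1}{(m-k)!\,(k-1)!}$ whenever $(v_{i_1},\dots,v_{i_k})$ is an ordering of all the elements of $T_e$ and $(v_{i_{k+1}},\dots,v_{i_m})$ is an ordering of all the elements of $H_e$; all other entries are $0$. *)

theory Defs
  imports "HOL-Analysis.Analysis" "HOL-Combinatorics.Combinatorics"
begin

text \<open>
  A hypermatrix of order \<open>m\<close> and dimension \<open>n = CARD('n)\<close> is a function on index lists; an index
  tuple \<open>(i\<^sub>1, \<dots>, i\<^sub>m)\<close> is a list of length \<open>m\<close>. The order \<open>m\<close> is passed separately, and only the
  entries at lists of length \<open>m\<close> are ever used.
\<close>

type_synonym 'n hypermatrix = "'n list \<Rightarrow> real"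

definition supersymmetric :: "nat \<Rightarrow> 'n hypermatrix \<Rightarrow> bool" where
  "supersymmetric m A \<longleftrightarrow>
     (\<forall>p ix. p permutes {..<m} \<longrightarrow> length ix = m \<longrightarrow> A (permute_list p ix) = A ix)"

text \<open>The vector \<open>A x\<^sup>m\<^sup>-\<^sup>1\<close> and the form \<open>A x\<^sup>m\<close>.\<close>

definition tensor_vec :: "nat \<Rightarrow> 'n::finite hypermatrix \<Rightarrow> real ^ 'n \<Rightarrow> real ^ 'n" where
  "tensor_vec m A x =
     (\<chi> i. \<Sum>ix | length ix = m - 1. A (i # ix) * (\<Prod>j\<leftarrow>ix. x $ j))"

definition tensor_form :: "nat \<Rightarrow> 'n::finite hypermatrix \<Rightarrow> real ^ 'n \<Rightarrow> real" where
  "tensor_form m A x = (\<Sum>ix | length ix = m. A ix * (\<Prod>j\<leftarrow>ix. x $ j))"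

text \<open>
  These notions are usually reserved for \<open>A \<noteq> 0\<close>. Here they are total: for \<open>A = 0\<close> the only
  Z-eigenvalue is \<open>0\<close>.
\<close>

definition Z_eigenpair :: "nat \<Rightarrow> 'n::finite hypermatrix \<Rightarrow> real \<Rightarrow> real ^ 'n \<Rightarrow> bool" where
  "Z_eigenpair m A l x \<longleftrightarrow> x \<noteq> 0 \<and> tensor_vec m A x = l *\<^sub>R x \<and> (\<Sum>i\<in>UNIV. (x $ i)\<^sup>2) = 1"

definition Z_eigenvalue :: "nat \<Rightarrow> 'n::finite hypermatrix \<Rightarrow> real \<Rightarrow> bool" where
  "Z_eigenvalue m A l \<longleftrightarrow> (\<exists>x. Z_eigenpair m A l x)"

definition max_Z_eigenvalue :: "nat \<Rightarrow> 'n::finite hypermatrix \<Rightarrow> real \<Rightarrow> bool" where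
  "max_Z_eigenvalue m A l \<longleftrightarrow> Z_eigenvalue m A l \<and> (\<forall>l'. Z_eigenvalue m A l' \<longrightarrow> l' \<le> l)"

text \<open>
  An edge is the pair \<open>(T, H)\<close> of its tail and its head; its underlying vertex set is \<open>T \<union> H\<close>.
\<close>

locale directed_hypergraph =
  fixes V :: "'v set" and E :: "('v set \<times> 'v set) set"
  assumes finite_V: "finite V"
    and edge_subset: "(T, H) \<in> E \<Longrightarrow> T \<union> H \<subseteq> V"
    and tail_nonempty: "(T, H) \<in> E \<Longrightarrow> T \<noteq> {}"
    and head_nonempty: "(T, H) \<in> E \<Longrightarrow> H \<noteq> {}"
    and tail_head_disjoint: "(T, H) \<in> E \<Longrightarrow> T \<inter> H = {}"
    and edges_distinct:
      "\<lbrakk>(T, H) \<in> E; (T', H') \<in> E; (T, H) \<noteq> (T', H')\<rbrakk> \<Longrightarrow> T \<union> H \<noteq> T' \<union> H'"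

definition uniform_edges :: "nat \<Rightarrow> ('v set \<times> 'v set) set \<Rightarrow> bool" where
  "uniform_edges m E \<longleftrightarrow> (\<forall>(T, H)\<in>E. card (T \<union> H) = m)"

text \<open>
  The vertices are enumerated by \<open>v\<close>. Distinct edges of a directed hypergraph have distinct
  underlying vertex sets, so at most one summand is nonzero for any given index list.
\<close>

definition out_adjacency ::
    "nat \<Rightarrow> ('n \<Rightarrow> 'v) \<Rightarrow> ('v set \<times> 'v set) set \<Rightarrow> 'n hypermatrix" where
  "out_adjacency m v E ix =
     (\<Sum>(T, H)\<in>E.
        if map v (take (card T) ix) \<in> permutations_of_set T \<and>
           map v (drop (card T) ix) \<in> permutations_of_set H
        then 1 / (fact (m - card T) * fact (card T - 1)) else 0)"

end

theory Submission
  imports Defs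
begin

text \<open>
  Pairing \<open>A x\<^sup>m\<^sup>-\<^sup>1 = \<lambda> x\<close> with the unit vector \<open>x\<close> gives \<open>\<lambda> = A x\<^sup>m\<close>: every Z-eigenvalue is a
  value of the form on the unit sphere. For a supersymmetric \<open>B\<close> the gradient of \<open>B x\<^sup>m\<close> is
  \<open>m (B x\<^sup>m\<^sup>-\<^sup>1)\<close> (\<open>has_derivative_tensor_form\<close>), so a maximiser of \<open>B x\<^sup>m\<close> on the sphere is a
  Z-eigenvector by Lagrange's rule (\<open>sphere_maximiser_gradient\<close>), and the largest Z-eigenvalue of
  \<open>B\<close> is the maximum of the form. A hypermatrix with the same form, symmetric or not, has all its
  Z-eigenvalues among the values of that form, hence below this maximum.

  The maximum on the other side has to be shown to exist. The Z-eigenvectors form a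
  compact set, so it is enough to find one of them. A hypermatrix that is not symmetric may have no
  real Z-eigenvector at all (a plane rotation, for \<open>m = 2\<close>), but the out-adjacency hypermatrix has
  nonnegative entries, and a Perron-Frobenius argument by Brouwer's fixed point theorem on the
  standard simplex applies (\<open>nonneg_Z_eigenvalue_exists\<close>).
\<close>

section \<open>The form and the vector of a hypermatrix\<close>

lemma tensor_vec_nth: "tensor_vec m A x $ i = tensor_form (m - 1) (\<lambda>ix. A (i # ix)) x"
  by (simp add: tensor_vec_def tensor_form_def)

lemma tensor_form_0: "tensor_form 0 A x = A []"
  by (simp add: tensor_form_def)

lemma tensor_form_Suc:
  "tensor_form (Suc m) A x = (\<Sum>i\<in>UNIV. x $ i * tensor_form m (\<lambda>ix. A (i # ix)) x)"
proof -
  have eq: "{ix :: 'a list. length ix = Suc m} = case_prod (#) ` (UNIV \<times> {ix. length ix = m})"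
    by (auto simp: length_Suc_conv image_iff)
  have inj: "inj_on (case_prod (#)) (UNIV \<times> {ix :: 'a list. length ix = m})"
    by (auto simp: inj_on_def)
  show ?thesis
    unfolding tensor_form_def eq sum.reindex[OF inj] sum_distrib_left
    by (simp add: sum.cartesian_product o_def case_prod_beta mult_ac)
qed

lemma inner_tensor_vec:
  assumes "m > 0"
  shows "x \<bullet> tensor_vec m A x = tensor_form m A x"
  using assms tensor_form_Suc[of "m - 1" A x] by (simp add: inner_vec_def tensor_vec_nth)

lemma tensor_form_scaleR: "tensor_form m A (c *\<^sub>R x) = c ^ m * tensor_form m A x"
  by (induction m arbitrary: A)
    (simp_all add: tensor_form_0 tensor_form_Suc sum_distrib_left mult_ac)

lemma tensor_vec_scaleR: "tensor_vec m A (c *\<^sub>R x) = c ^ (m - 1) *\<^sub>R tensor_vec m A x"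
  by (simp add: vec_eq_iff tensor_vec_nth tensor_form_scaleR)

lemma continuous_on_tensor_form: "continuous_on S (tensor_form m A)"
  by (induction m arbitrary: A)
    (auto simp: tensor_form_0 tensor_form_Suc[abs_def] intro!: continuous_intros)

lemma continuous_on_tensor_vec: "continuous_on S (tensor_vec m A)"
  by (subst continuous_on_componentwise)
    (auto simp: Basis_vec_def inner_axis tensor_vec_nth continuous_on_tensor_form)

lemma tensor_form_nonneg:
  assumes "\<And>ix. 0 \<le> A ix" "\<And>i. 0 \<le> x $ i"
  shows "0 \<le> tensor_form m A x"
  using assms(1)
  by (induction m arbitrary: A)
    (auto simp: tensor_form_0 tensor_form_Suc assms(2) intro!: sum_nonneg mult_nonneg_nonneg)

lemma Z_eigenpair_iff: "Z_eigenpair m A l x \<longleftrightarrow> norm x = 1 \<and> tensor_vec m A x = l *\<^sub>R x"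
proof -
  have "(\<Sum>i\<in>UNIV. (x $ i)\<^sup>2) = (norm x)\<^sup>2"
    unfolding power2_norm_eq_inner by (simp add: inner_vec_def power2_eq_square)
  then show ?thesis
    by (auto simp: Z_eigenpair_def abs_square_eq_1)
qed

lemma Z_eigenpair_eq_form:
  assumes "Z_eigenpair m A l x" "m > 0"
  shows "l = tensor_form m A x"
proof -
  have "x \<bullet> x = 1"
    using assms(1) by (simp add: Z_eigenpair_iff norm_eq_1)
  then show ?thesis
    using assms inner_tensor_vec[of m x A] by (simp add: Z_eigenpair_iff)
qed

section \<open>Supersymmetric hypermatrices\<close>

lemma supersymmetric_mset_cong:
  assumes "supersymmetric m A" "mset xs = mset ys" "length xs = m"
  shows "A xs = A ys"
proof -
  obtain p where "p permutes {..<length ys}" "permute_list p ys = xs"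
    using mset_eq_permutation[OF assms(2)] by auto
  moreover have "length ys = m"
    using assms(2,3) mset_eq_length by force
  ultimately show ?thesis
    using assms(1) by (auto simp: supersymmetric_def)
qed

lemma supersymmetric_slice:
  assumes "supersymmetric (Suc m) A"
  shows "supersymmetric m (\<lambda>ix. A (i # ix))"
  unfolding supersymmetric_def
  by (intro allI impI supersymmetric_mset_cong[OF assms]) auto

text \<open>
  Induction along the first index: differentiating the other factors gives, for each value of the
  first index, the vector of a slice. Symmetry in the first two indices then moves the
  differentiated factor to the front, so each of the \<open>m\<close> factors contributes equally.
\<close>

lemma has_derivative_tensor_form:
  assumes "supersymmetric m A"
  shows "(tensor_form m A has_derivative (\<lambda>h. real m * (tensor_vec m A x \<bullet> h))) (at x)"
  using assms
proof (induction m arbitrary: A)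
  case 0
  show ?case by (simp add: tensor_form_0[abs_def])
next
  case (Suc m)
  let ?A = "\<lambda>i ix. A (i # ix)"
  have swap: "(\<Sum>i\<in>UNIV. x $ i * (real m * (tensor_vec m (?A i) x \<bullet> h))) =
      real m * (tensor_vec (Suc m) A x \<bullet> h)" for h
  proof (cases m)
    case (Suc k)
    have form_swap: "tensor_form k (\<lambda>ix. A (i # j # ix)) x = tensor_form k (\<lambda>ix. A (j # i # ix)) x"
      for i j
      unfolding tensor_form_def
      by (intro sum.cong arg_cong2[where f = "(*)"] supersymmetric_mset_cong[OF Suc.prems])
        (auto simp: Suc)
    have "(\<Sum>i\<in>UNIV. x $ i * (tensor_vec m (?A i) x \<bullet> h)) =
        (\<Sum>i\<in>UNIV. \<Sum>j\<in>UNIV. h $ j * (x $ i * tensor_form k (\<lambda>ix. A (i # j # ix)) x))"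
      by (simp add: inner_vec_def tensor_vec_nth Suc sum_distrib_left mult_ac)
    also have "\<dots> = (\<Sum>j\<in>UNIV. h $ j * (\<Sum>i\<in>UNIV. x $ i * tensor_form k (\<lambda>ix. A (j # i # ix)) x))"
      by (subst sum.swap) (simp add: sum_distrib_left form_swap)
    also have "\<dots> = tensor_vec (Suc m) A x \<bullet> h"
      by (simp add: inner_vec_def tensor_vec_nth Suc tensor_form_Suc mult_ac)
    finally show ?thesis
      by (simp add: sum_distrib_left mult.left_commute[of _ "real m"] flip: sum_distrib_left)
  qed simp
  have IH: "(tensor_form m (?A i) has_derivative
      (\<lambda>h. real m * (tensor_vec m (?A i) x \<bullet> h))) (at x)" for i
    using Suc.IH supersymmetric_slice[OF Suc.prems] by blast
  have nth: "((\<lambda>y. y $ i) has_derivative (\<lambda>h. h $ i)) (at x)" for i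
    by (intro bounded_linear_imp_has_derivative bounded_linear_vec_nth)
  have "((\<lambda>y. \<Sum>i\<in>UNIV. y $ i * tensor_form m (?A i) y) has_derivative
      (\<lambda>h. \<Sum>i\<in>UNIV. x $ i * (real m * (tensor_vec m (?A i) x \<bullet> h)) +
        h $ i * tensor_form m (?A i) x)) (at x)"
    by (intro has_derivative_sum has_derivative_mult nth IH)
  moreover have "(\<Sum>i\<in>UNIV. x $ i * (real m * (tensor_vec m (?A i) x \<bullet> h)) +
        h $ i * tensor_form m (?A i) x) = real (Suc m) * (tensor_vec (Suc m) A x \<bullet> h)" for h
    unfolding sum.distrib swap
    by (simp add: inner_vec_def tensor_vec_nth algebra_simps)
  ultimately show ?case
    by (simp only: tensor_form_Suc[abs_def])
qed

text \<open>
  Lagrange's rule on the unit sphere. If the tangential part of the gradient were nonzero, the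
  function would not be stationary along the great circle through \<open>x\<close> in that direction.
\<close>

lemma sphere_maximiser_gradient:
  fixes f :: "'a::real_inner \<Rightarrow> real"
  assumes der: "(f has_derivative (\<lambda>h. g \<bullet> h)) (at x)"
    and x: "norm x = 1" and max: "\<And>y. norm y = 1 \<Longrightarrow> f y \<le> f x"
  shows "g = (g \<bullet> x) *\<^sub>R x"
proof (rule ccontr)
  assume neq: "g \<noteq> (g \<bullet> x) *\<^sub>R x"
  define w where "w = g - (g \<bullet> x) *\<^sub>R x"
  define y where "y = w /\<^sub>R norm w"
  have xx: "x \<bullet> x = 1" and w: "w \<noteq> 0"
    using x neq by (auto simp: norm_eq_1 w_def)
  have wx: "w \<bullet> x = 0"
    by (simp add: w_def inner_diff_left xx)
  then have yx: "y \<bullet> x = 0" and yy: "y \<bullet> y = 1"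
    using w by (auto simp: y_def dot_square_norm power2_eq_square)
  define c where "c t = cos t *\<^sub>R x + sin t *\<^sub>R y" for t
  have "norm (c t) = 1" for t
    by (simp add: norm_eq_1 c_def inner_add_left inner_add_right xx yy yx inner_commute[of x y]
        flip: power2_eq_square)
  then have le: "f (c t) \<le> f (c 0)" for t
    using max by (simp add: c_def)
  have "(c has_vector_derivative y) (at 0)"
    unfolding c_def by (auto intro!: derivative_eq_intros simp: has_vector_derivative_def)
  then have "((\<lambda>t. f (c t)) has_derivative (\<lambda>t. g \<bullet> (t *\<^sub>R y))) (at 0)"
    unfolding has_vector_derivative_def
    by (rule has_derivative_compose) (simp add: c_def der)
  then have "((\<lambda>t. f (c t)) has_real_derivative g \<bullet> y) (at 0)"
    by (simp add: has_field_derivative_def mult_commute_abs)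
  then have "g \<bullet> y = 0"
    by (rule DERIV_local_max[where d = 1]) (auto intro: le)
  moreover have "g \<bullet> y = w \<bullet> y"
    by (simp add: w_def inner_diff_left inner_commute[of x y] yx)
  ultimately show False
    using w by (simp add: y_def)
qed

lemma supersymmetric_sphere_maximiser_Z_eigenpair:
  assumes "supersymmetric m B" "m > 0" "norm x = 1"
    and "\<And>y. norm y = 1 \<Longrightarrow> tensor_form m B y \<le> tensor_form m B x"
  shows "Z_eigenpair m B (tensor_form m B x) x"
proof -
  let ?b = "tensor_vec m B x"
  have "(tensor_form m B has_derivative (\<lambda>h. (real m *\<^sub>R ?b) \<bullet> h)) (at x)"
    using has_derivative_tensor_form[OF assms(1)] by simp
  from sphere_maximiser_gradient[OF this assms(3,4)]
  have "real m *\<^sub>R ?b = real m *\<^sub>R ((?b \<bullet> x) *\<^sub>R x)"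
    by simp
  then have "?b = (?b \<bullet> x) *\<^sub>R x"
    using assms(2) by (simp only: scaleR_cancel_left) simp
  then show ?thesis
    using assms(2,3) inner_tensor_vec[of m x B] by (simp add: Z_eigenpair_iff inner_commute)
qed

section \<open>Existence of a largest Z-eigenvalue\<close>

text \<open>
  Writing the eigenvalue as \<open>A x\<^sup>m\<close> eliminates it from the eigenvector equation, which then cuts out
  a closed subset of the sphere.
\<close>

lemma max_Z_eigenvalue_exists:
  fixes A :: "'n::finite hypermatrix"
  assumes "Z_eigenvalue m A l" "m > 0"
  shows "\<exists>l'. max_Z_eigenvalue m A l'"
proof -
  let ?S = "{x \<in> sphere (0 :: real ^ 'n) 1. tensor_vec m A x - tensor_form m A x *\<^sub>R x = 0}"
  have ev: "Z_eigenvalue m A k \<longleftrightarrow> (\<exists>x\<in>?S. k = tensor_form m A x)" for k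
    using Z_eigenpair_eq_form[OF _ assms(2)]
    by (auto simp: Z_eigenvalue_def Z_eigenpair_iff)
  have "closed ?S"
    by (intro continuous_closed_preimage_constant continuous_intros continuous_on_tensor_form
        continuous_on_tensor_vec) simp
  moreover have "bounded ?S"
    by (rule bounded_subset[OF bounded_sphere[of 0 1]]) auto
  ultimately have "compact ?S"
    by (simp add: compact_eq_bounded_closed)
  moreover have "?S \<noteq> {}"
    using assms(1) ev by blast
  ultimately obtain x where x: "x \<in> ?S"
    and max: "\<forall>y\<in>?S. tensor_form m A y \<le> tensor_form m A x"
    using continuous_attains_sup[of ?S "tensor_form m A", OF _ _ continuous_on_tensor_form]
    by blast
  have "Z_eigenvalue m A (tensor_form m A x)"
    unfolding ev by (intro bexI[OF _ x] refl)
  moreover have "k \<le> tensor_form m A x" if "Z_eigenvalue m A k" for k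
    using that max unfolding ev by (elim bexE) (simp only: Ball_def)
  ultimately show ?thesis
    unfolding max_Z_eigenvalue_def by blast
qed

text \<open>
  The Perron-Frobenius argument: on the standard simplex, \<open>x + A x\<^sup>m\<^sup>-\<^sup>1\<close> rescaled to coordinate sum
  \<open>1\<close> is a continuous self-map, and Brouwer's theorem provides a fixed point. Adding \<open>x\<close> keeps the
  rescaling possible where \<open>A x\<^sup>m\<^sup>-\<^sup>1\<close> vanishes. A fixed point has \<open>A x\<^sup>m\<^sup>-\<^sup>1\<close> proportional to
  \<open>x\<close>, and by homogeneity this persists after passing to Euclidean norm \<open>1\<close>.
\<close>

lemma nonneg_Z_eigenvalue_exists:
  fixes A :: "'n::finite hypermatrix"
  assumes nonneg: "\<And>ix. 0 \<le> A ix"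
  shows "\<exists>l. Z_eigenvalue m A l"
proof -
  let ?S = "{x :: real ^ 'n. (\<forall>i. 0 \<le> x $ i) \<and> (\<Sum>i\<in>UNIV. x $ i) = 1}"
  let ?s = "\<lambda>x. \<Sum>i\<in>UNIV. tensor_vec m A x $ i"
  let ?F = "\<lambda>x. inverse (1 + ?s x) *\<^sub>R (x + tensor_vec m A x)"
  have vec: "0 \<le> tensor_vec m A x $ i" if "x \<in> ?S" for x i
    using that by (auto simp: tensor_vec_nth intro!: tensor_form_nonneg nonneg)
  have s: "0 \<le> ?s x" if "x \<in> ?S" for x
    using vec[OF that] by (rule sum_nonneg)
  have "closed ?S"
    by (intro closed_Collect_conj closed_Collect_all closed_Collect_le closed_Collect_eq
        continuous_intros)
  moreover have "bounded ?S"
    unfolding bounded_iff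
  proof (intro exI ballI)
    fix x :: "real ^ 'n"
    assume "x \<in> ?S"
    then show "norm x \<le> 1"
      using norm_le_l1_cart[of x] by simp
  qed
  ultimately have "compact ?S"
    by (simp add: compact_eq_bounded_closed)
  moreover have "convex ?S"
    by (auto simp: convex_def sum.distrib simp flip: sum_distrib_left)
  moreover have "axis undefined 1 \<in> ?S"
    by (auto simp: axis_def)
  moreover have "continuous_on ?S ?F"
  proof (intro continuous_intros continuous_on_tensor_vec ballI)
    fix x :: "real ^ 'n"
    assume "x \<in> ?S"
    then show "1 + ?s x \<noteq> 0"
      using s[of x] by linarith
  qed
  moreover have "?F ` ?S \<subseteq> ?S"
  proof safe
    fix x :: "real ^ 'n" and i
    assume x: "\<forall>i. 0 \<le> x $ i" "(\<Sum>i\<in>UNIV. x $ i) = 1"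
    then have xS: "x \<in> ?S" by simp
    show "0 \<le> ?F x $ i"
      using x(1) s[OF xS] vec[OF xS] by simp
    show "(\<Sum>i\<in>UNIV. ?F x $ i) = 1"
      using s[OF xS] x(2) by (simp add: sum.distrib flip: sum_distrib_left)
  qed
  ultimately obtain x where xS: "x \<in> ?S" and fixpoint: "?F x = x"
    using brouwer[of ?S ?F] by blast
  have x0: "x \<noteq> 0"
    using xS by auto
  have "x + tensor_vec m A x = (1 + ?s x) *\<^sub>R ?F x"
    using s[OF xS] by simp
  then have eigen: "tensor_vec m A x = ?s x *\<^sub>R x"
    unfolding fixpoint by (simp add: scaleR_add_left)
  define c where "c = inverse (norm x)"
  have c: "c \<noteq> 0"
    using x0 by (simp add: c_def)
  have "tensor_vec m A (c *\<^sub>R x) = (c ^ (m - 1) * ?s x / c) *\<^sub>R (c *\<^sub>R x)"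
    unfolding tensor_vec_scaleR by (subst eigen) (use c in simp)
  moreover have "norm (c *\<^sub>R x) = 1"
    using x0 by (simp add: c_def)
  ultimately show ?thesis
    unfolding Z_eigenvalue_def Z_eigenpair_iff by blast
qed

lemma out_adjacency_nonneg: "0 \<le> out_adjacency m v E ix"
  unfolding out_adjacency_def by (intro sum_nonneg) (auto split: prod.splits)

section \<open>Comparison of the largest Z-eigenvalues\<close>

theorem theorem5:
  fixes V :: "'v set" and E :: "('v set \<times> 'v set) set"
    and v :: "'n::finite \<Rightarrow> 'v" and m :: nat and B :: "'n hypermatrix"
  assumes "directed_hypergraph V E"
    and "uniform_edges m E"
    and "bij_betw v UNIV V"
    and "even m" and "m > 0"
    and "supersymmetric m B"
    and "\<And>x. tensor_form m B x = tensor_form m (out_adjacency m v E) x"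
  shows "\<exists>l l'. max_Z_eigenvalue m (out_adjacency m v E) l \<and> max_Z_eigenvalue m B l' \<and> l \<le> l'"
proof -
  let ?A = "out_adjacency m v E"
  obtain l where l: "max_Z_eigenvalue m ?A l"
    using nonneg_Z_eigenvalue_exists[of ?A m] max_Z_eigenvalue_exists[OF _ \<open>m > 0\<close>]
      out_adjacency_nonneg by blast
  have "axis undefined 1 \<in> sphere (0 :: real ^ 'n) 1"
    by (simp add: norm_axis_1)
  then obtain x where "x \<in> sphere (0 :: real ^ 'n) 1"
    and x_max: "\<forall>y\<in>sphere 0 1. tensor_form m B y \<le> tensor_form m B x"
    using continuous_attains_sup[OF compact_sphere _ continuous_on_tensor_form] by (metis empty_iff)
  then have "Z_eigenpair m B (tensor_form m B x) x"
    using supersymmetric_sphere_maximiser_Z_eigenpair[OF assms(6,5)] by simp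
  moreover have bound: "k \<le> tensor_form m B x"
    if "Z_eigenpair m C k y" "tensor_form m C y = tensor_form m B y" for C k y
    using that x_max Z_eigenpair_eq_form[OF that(1) \<open>m > 0\<close>] by (simp add: Z_eigenpair_iff)
  ultimately have "max_Z_eigenvalue m B (tensor_form m B x)"
    unfolding max_Z_eigenvalue_def Z_eigenvalue_def by blast
  moreover have "l \<le> tensor_form m B x"
    using l bound assms(7) unfolding max_Z_eigenvalue_def Z_eigenvalue_def by metis
  ultimately show ?thesis
    using l by blast
qed

end
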